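(* The bits of precision needed to embed a graph with longest path $\ell$ and maximum degree $\deg_{\max}$ into the Poincaré disk $\mathbb{H}_2$ with worst-case distortion at most $1+\varepsilon$ is $$\Omega\left(\frac{\ell}{\varepsilon}\log(\deg_{\max})\right).$$
   Context: The Poincaré disk $\mathbb{H}_2$ is the open unit disk of $\mathbb{R}^2$ with distance $d_H(x,y)=\operatorname{acosh}\left(1+2\frac{\|x-y\|^2}{(1-\|x\|^2)(1-\|y\|^2)}\right)$. Worst-case distortion of an embedding $f$ of a graph $G$ with shortest-path distance $d_G$: $D_{\mathrm{wc}}(f)=\dfrac{\max_{u\ne v} d_H(f(u),f(v))/d_G(u,v)}{\min_{u\neq v} d_H(f(u),f(v))/d_G(u,v)}$. Representing a point $x$ of the disk requires about $\log\frac{1}{1-\|x\|}$ bits of precision (so that $1-\|x\|$ is not rounded to zero). The lower bound is meant in the following sense: it is attained by an explicit graph, for any embedding of that graph into $\mathbb{H}_2$. The explicit graph $G_m$ is a tree consisting of a root node with $\deg_{\max}$ chains attached to it, each chain having $m$ nodes, for a total of $1+m\deg_{\max}$ nodes; its longest path has length $\ell=2m$.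
   Formalization: The bound is proved for maximum degree at least 3 and 1+ε at most deg_max^κ for some absolute constant κ>0 (all small ε, or bounded ε with large degree); without such a limit it fails, e.g. degree 3, ε=0.2, with the tree drawn as three tiny equally spaced rays. *)

theory Defs
  imports "HOL-Analysis.Analysis" "Graph_Theory.Graph_Theory"
begin

section \<open>The Poincare disk\<close>

definition poincare_disk :: "(real ^ 2) set" where
  "poincare_disk = ball 0 1"

definition hyp_dist :: "real ^ 2 \<Rightarrow> real ^ 2 \<Rightarrow> real" where
  "hyp_dist x y =
    arcosh (1 + 2 * (norm (x - y))\<^sup>2 / ((1 - (norm x)\<^sup>2) * (1 - (norm y)\<^sup>2)))"

section \<open>Distances, degrees and paths in graphs\<close>

text \<open>
  An undirected simple graph is a digraph satisfying \<^locale>\<open>graph\<close> (finite, loop-free,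
  without parallel arcs, symmetric): every edge is represented by its two opposite arcs. The
  degree of a vertex is therefore its out-degree, and a path (no repeated vertex) has as many
  edges as arcs.
\<close>

definition graph_dist :: "('a, 'b) pre_digraph \<Rightarrow> 'a \<Rightarrow> 'a \<Rightarrow> real" where
  "graph_dist G u v = real_of_ereal (wf_digraph.\<mu> G (\<lambda>_. 1) u v)"

definition max_degree :: "('a, 'b) pre_digraph \<Rightarrow> nat" where
  "max_degree G = Max (out_degree G ` verts G)"

definition longest_path_length :: "('a, 'b) pre_digraph \<Rightarrow> nat" where
  "longest_path_length G = Max {length p | u p v. pre_digraph.apath G u p v}"

section \<open>Embeddings, distortion and precision\<close>

text \<open>
  Injectivity makes the denominator of the worst-case distortion positive; without it the
  distortion would be infinite, whereas division by zero in HOL would make it 0.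
\<close>

definition disk_embedding :: "('a, 'b) pre_digraph \<Rightarrow> ('a \<Rightarrow> real ^ 2) \<Rightarrow> bool" where
  "disk_embedding G f \<longleftrightarrow> f ` verts G \<subseteq> poincare_disk \<and> inj_on f (verts G)"

definition dist_ratios :: "('a, 'b) pre_digraph \<Rightarrow> ('a \<Rightarrow> real ^ 2) \<Rightarrow> real set" where
  "dist_ratios G f =
    {hyp_dist (f u) (f v) / graph_dist G u v | u v. u \<in> verts G \<and> v \<in> verts G \<and> u \<noteq> v}"

definition wc_distortion :: "('a, 'b) pre_digraph \<Rightarrow> ('a \<Rightarrow> real ^ 2) \<Rightarrow> real" where
  "wc_distortion G f = Max (dist_ratios G f) / Min (dist_ratios G f)"

definition point_bits :: "real ^ 2 \<Rightarrow> real" where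
  "point_bits x = log 2 (1 / (1 - norm x))"

text \<open>
  All embedded vertices have to be represented, so an embedding needs the precision of its
  most demanding point.
\<close>

definition embedding_bits :: "('a, 'b) pre_digraph \<Rightarrow> ('a \<Rightarrow> real ^ 2) \<Rightarrow> real" where
  "embedding_bits G f = Max ((\<lambda>v. point_bits (f v)) ` verts G)"

section \<open>The tree of chains attached to a root\<close>

text \<open>
  \<open>Chain i j\<close> is the \<open>j\<close>-th node of the \<open>i\<close>-th chain, counted from 1 at the node adjacent to
  the root.
\<close>

datatype chain_vertex = Root | Chain nat nat

definition chain_tree_edges :: "nat \<Rightarrow> nat \<Rightarrow> (chain_vertex \<times> chain_vertex) set" where
  "chain_tree_edges m \<Delta> =
    {(Root, Chain i 1) | i. i < \<Delta> \<and> 1 \<le> m} \<union>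
    {(Chain i j, Chain i (Suc j)) | i j. i < \<Delta> \<and> 1 \<le> j \<and> j < m}"

definition chain_tree :: "nat \<Rightarrow> nat \<Rightarrow> (chain_vertex, chain_vertex \<times> chain_vertex) pre_digraph" where
  "chain_tree m \<Delta> = with_proj
    \<lparr> pverts = insert Root {Chain i j | i j. i < \<Delta> \<and> 1 \<le> j \<and> j \<le> m},
      parcs = chain_tree_edges m \<Delta> \<union> (chain_tree_edges m \<Delta>)\<inverse> \<rparr>"

text \<open>
  A precision bound in terms of the maximum degree \<open>\<Delta>\<close> needs a restriction on \<open>\<Delta>\<close> and on the
  admitted distortion \<open>1 + \<epsilon>\<close>. For \<open>\<Delta> \<le> 2\<close> the tree is a path, which embeds isometrically
  up to scale into an arbitrarily short geodesic through the origin. For \<open>\<Delta> \<ge> 2\<close>, drawing the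
  chains as \<open>\<Delta>\<close> equally spaced rays in a tiny disk around the origin has a distortion that
  tends to \<open>1 / sin (pi / \<Delta>)\<close>, about \<open>\<Delta> / pi\<close>, as the scale tends to 0. The asymptotic bound
  is hence stated for \<open>\<Delta> \<ge> 3\<close> and \<open>1 + \<epsilon> \<le> \<Delta> powr \<kappa>\<close> with a constant \<open>\<kappa> > 0\<close>. This covers
  all sufficiently small \<open>\<epsilon>\<close> uniformly in \<open>\<Delta> \<ge> 3\<close>, and, for every bounded range of \<open>\<epsilon>\<close>, all
  sufficiently large \<open>\<Delta>\<close>.
\<close>

end

theory Submission
  imports Defs
begin

text \<open>
  Let \<open>s\<close> be the smallest ratio of hyperbolic distance to graph distance. Seen from the image of
  the root, the \<open>\<Delta>\<close> neighbours have radii in \<open>[s, (1 + \<epsilon>) s]\<close> and pairwise distances at least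
  \<open>2 s\<close>. Two of them are seen under a small angle, so by the hyperbolic law of cosines
  \<open>sinh ((1 + \<epsilon>) s) / sinh s\<close> is at least a power of \<open>\<Delta>\<close>; since this quotient is at most
  \<open>(1 + \<epsilon>) exp (\<epsilon> s)\<close>, the scale \<open>s\<close> is at least of order \<open>log \<Delta> / \<epsilon>\<close>. Two leaves are then at
  distance at least \<open>2 m s\<close>, hence one of them is at distance at least \<open>m s\<close> from the origin, and
  the precision is linear in this distance.
\<close>

section \<open>Hyperbolic trigonometry in the disk\<close>

definition to_complex :: "real ^ 2 \<Rightarrow> complex" where
  "to_complex x = Complex (x $ 1) (x $ 2)"

lemma to_complex_diff: "to_complex (x - y) = to_complex x - to_complex y"
  by (simp add: to_complex_def complex_eq_iff)

lemma norm_to_complex: "norm (to_complex x) = norm x"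
  by (simp add: to_complex_def norm_vec_def L2_set_def cmod_def sum_2)

text \<open>The disk automorphism that sends \<open>a\<close> to the origin.\<close>

definition disk_shift :: "complex \<Rightarrow> complex \<Rightarrow> complex" where
  "disk_shift a z = (z - a) / (1 - cnj a * z)"

lemma disk_shift_denom_nonzero:
  assumes "norm a < 1" "norm z < 1"
  shows "1 - cnj a * z \<noteq> 0"
proof
  assume "1 - cnj a * z = 0"
  hence "norm (cnj a * z) = 1" by (metis eq_iff_diff_eq_0 norm_one)
  moreover have "norm a * norm z < 1 * 1"
    using assms by (intro mult_strict_mono') auto
  ultimately show False by (simp add: norm_mult)
qed

text \<open>Rests on the identity |1 - cnj a * z|^2 - |z - a|^2 = (1 - |a|^2) * (1 - |z|^2).\<close>

lemma one_minus_norm_disk_shift: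
  assumes "norm a < 1" "norm z < 1"
  shows "1 - (norm (disk_shift a z))\<^sup>2 =
    (1 - (norm a)\<^sup>2) * (1 - (norm z)\<^sup>2) / (norm (1 - cnj a * z))\<^sup>2"
proof -
  have "(norm (1 - cnj a * z))\<^sup>2 - (norm (z - a))\<^sup>2 = (1 - (norm a)\<^sup>2) * (1 - (norm z)\<^sup>2)"
    unfolding cmod_power2 by (simp add: power2_eq_square algebra_simps)
  thus ?thesis using disk_shift_denom_nonzero[OF assms]
    by (simp add: disk_shift_def norm_divide power_divide field_simps)
qed

lemma norm_disk_shift_less_1:
  assumes "norm a < 1" "norm z < 1"
  shows "norm (disk_shift a z) < 1"
proof -
  have "(norm a)\<^sup>2 < 1" "(norm z)\<^sup>2 < 1" using assms by (simp_all add: power_less_one_iff)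
  hence "1 - (norm (disk_shift a z))\<^sup>2 > 0"
    unfolding one_minus_norm_disk_shift[OF assms]
    using disk_shift_denom_nonzero[OF assms] by simp
  thus ?thesis by (simp add: power_less_one_iff)
qed

lemma disk_shift_diff:
  assumes "norm a < 1" "norm z < 1" "norm w < 1"
  shows "disk_shift a z - disk_shift a w =
    (z - w) * (1 - a * cnj a) / ((1 - cnj a * z) * (1 - cnj a * w))"
  using disk_shift_denom_nonzero[OF assms(1,2)] disk_shift_denom_nonzero[OF assms(1,3)]
  unfolding disk_shift_def by (simp add: divide_simps) (simp add: algebra_simps)

text \<open>The factors \<open>A\<close>, \<open>P\<close> and \<open>Q\<close> picked up by the
  numerator and by the two conformal factors cancel. This makes \<open>disk_shift\<close> an
  isometry of \<open>hyp_dist\<close>.\<close>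

lemma disk_shift_invariant:
  assumes "norm a < 1" "norm z < 1" "norm w < 1"
  shows "(norm (disk_shift a z - disk_shift a w))\<^sup>2 /
      ((1 - (norm (disk_shift a z))\<^sup>2) * (1 - (norm (disk_shift a w))\<^sup>2)) =
    (norm (z - w))\<^sup>2 / ((1 - (norm z)\<^sup>2) * (1 - (norm w)\<^sup>2))"
proof -
  define A P Q where "A = 1 - (norm a)\<^sup>2" and "P = norm (1 - cnj a * z)"
    and "Q = norm (1 - cnj a * w)"
  have A: "A > 0" using assms(1) by (simp add: A_def power_less_one_iff)
  have PQ: "P \<noteq> 0" "Q \<noteq> 0"
    using disk_shift_denom_nonzero[OF assms(1,2)] disk_shift_denom_nonzero[OF assms(1,3)]
    by (simp_all add: P_def Q_def)
  have "1 - a * cnj a = of_real A"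
    unfolding A_def by (simp flip: complex_norm_square)
  hence "norm (1 - a * cnj a) = A" using A by simp
  hence diff: "norm (disk_shift a z - disk_shift a w) = norm (z - w) * A / (P * Q)"
    unfolding disk_shift_diff[OF assms] norm_divide norm_mult P_def Q_def by simp
  have "1 - (norm (disk_shift a z))\<^sup>2 = A * (1 - (norm z)\<^sup>2) / P\<^sup>2"
    "1 - (norm (disk_shift a w))\<^sup>2 = A * (1 - (norm w)\<^sup>2) / Q\<^sup>2"
    unfolding A_def P_def Q_def
    by (rule one_minus_norm_disk_shift[OF assms(1,2)] one_minus_norm_disk_shift[OF assms(1,3)])+
  thus ?thesis using A PQ unfolding diff by (simp add: power2_eq_square)
qed

section \<open>The distance through its hyperbolic cosine\<close>

lemma poincare_disk_iff: "x \<in> poincare_disk \<longleftrightarrow> norm x < 1"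
  by (simp add: poincare_disk_def)

text \<open>On the disk this is \<open>(sinh (d / 2)) ^ 2\<close> for the hyperbolic distance
  \<open>d\<close>.\<close>

definition disk_quot :: "complex \<Rightarrow> complex \<Rightarrow> real" where
  "disk_quot z w = (norm (z - w))\<^sup>2 / ((1 - (norm z)\<^sup>2) * (1 - (norm w)\<^sup>2))"

lemma disk_quot_nonneg: "norm z < 1 \<Longrightarrow> norm w < 1 \<Longrightarrow> disk_quot z w \<ge> 0"
  by (simp add: disk_quot_def power_le_one)

lemma hyp_dist_eq: "hyp_dist x y = arcosh (1 + 2 * disk_quot (to_complex x) (to_complex y))"
  by (simp add: hyp_dist_def disk_quot_def norm_to_complex flip: to_complex_diff)

lemma hyp_dist_nonneg: "x \<in> poincare_disk \<Longrightarrow> y \<in> poincare_disk \<Longrightarrow> hyp_dist x y \<ge> 0"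
  unfolding hyp_dist_eq
  by (simp add: disk_quot_nonneg poincare_disk_iff norm_to_complex)

lemma cosh_hyp_dist:
  "x \<in> poincare_disk \<Longrightarrow> y \<in> poincare_disk \<Longrightarrow>
    cosh (hyp_dist x y) = 1 + 2 * disk_quot (to_complex x) (to_complex y)"
  unfolding hyp_dist_eq
  by (simp add: disk_quot_nonneg poincare_disk_iff norm_to_complex)

lemma hyp_dist_pos:
  assumes "x \<in> poincare_disk" "y \<in> poincare_disk" "x \<noteq> y"
  shows "hyp_dist x y > 0"
proof -
  have "to_complex x \<noteq> to_complex y" using assms(3)
    by (metis norm_eq_zero norm_to_complex right_minus_eq to_complex_diff)
  hence "disk_quot (to_complex x) (to_complex y) > 0"
    using assms by (simp add: disk_quot_def poincare_disk_iff norm_to_complex power_less_one_iff)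
  hence "cosh (hyp_dist x y) \<noteq> 1" using cosh_hyp_dist[OF assms(1,2)] by simp
  thus ?thesis using hyp_dist_nonneg[OF assms(1,2)] by (metis cosh_0 less_eq_real_def)
qed

lemma cosh_sinh_disk_radius:
  assumes "norm z < 1" "d \<ge> 0" "cosh d = 1 + 2 * disk_quot 0 z"
  shows "cosh d = (1 + (norm z)\<^sup>2) / (1 - (norm z)\<^sup>2)"
    and "sinh d = 2 * norm z / (1 - (norm z)\<^sup>2)"
proof -
  have z: "1 - (norm z)\<^sup>2 > 0" using assms(1) by (simp add: power_less_one_iff)
  show *: "cosh d = (1 + (norm z)\<^sup>2) / (1 - (norm z)\<^sup>2)"
    using z by (simp add: assms(3) disk_quot_def field_simps)
  have "(sinh d)\<^sup>2 = (cosh d)\<^sup>2 - 1" by (simp add: cosh_square_eq)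
  also have "\<dots> = (2 * norm z / (1 - (norm z)\<^sup>2))\<^sup>2"
    unfolding * using z by (simp add: divide_simps) (simp add: power2_eq_square algebra_simps)
  finally show "sinh d = 2 * norm z / (1 - (norm z)\<^sup>2)"
    by (rule power2_eq_imp_eq) (use assms z in auto)
qed

text \<open>The unit tangent vector at \<open>r\<close> towards \<open>x\<close>, read off after
  \<open>r\<close> is moved to the origin, where geodesics through the centre are straight. Inner
  products of directions are cosines of angles at \<open>r\<close>. For \<open>x = r\<close> the
  value is 0.\<close>

definition direction :: "real ^ 2 \<Rightarrow> real ^ 2 \<Rightarrow> complex" where
  "direction r x = sgn (disk_shift (to_complex r) (to_complex x))"

lemma norm_direction:
  assumes "x \<in> poincare_disk" "r \<in> poincare_disk" "x \<noteq> r"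
  shows "norm (direction r x) = 1"
proof -
  have "to_complex x \<noteq> to_complex r" using assms(3)
    by (metis norm_eq_zero norm_to_complex right_minus_eq to_complex_diff)
  moreover have "1 - cnj (to_complex r) * to_complex x \<noteq> 0"
    using assms by (intro disk_shift_denom_nonzero) (auto simp: poincare_disk_iff norm_to_complex)
  ultimately show ?thesis unfolding direction_def norm_sgn by (simp add: disk_shift_def)
qed

lemma norm_direction_le_1: "norm (direction r x) \<le> 1"
  by (simp add: direction_def norm_sgn)

text \<open>A Moebius automorphism of the disk moves \<open>r\<close> to the origin, where the law is a
  computation.\<close>
lemma hyperbolic_law_of_cosines:
  assumes r: "r \<in> poincare_disk" and x: "x \<in> poincare_disk" and y: "y \<in> poincare_disk"
  shows "cosh (hyp_dist x y) = cosh (hyp_dist r x) * cosh (hyp_dist r y) -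
    sinh (hyp_dist r x) * sinh (hyp_dist r y) * (direction r x \<bullet> direction r y)"
proof -
  define a where "a = to_complex r"
  define z w where "z = disk_shift a (to_complex x)" and "w = disk_shift a (to_complex y)"
  have n: "norm a < 1" "norm (to_complex x) < 1" "norm (to_complex y) < 1"
    using assms by (auto simp: a_def poincare_disk_iff norm_to_complex)
  have zw: "norm z < 1" "norm w < 1" using n by (auto simp: z_def w_def norm_disk_shift_less_1)
  have a0: "disk_shift a a = 0" by (simp add: disk_shift_def)
  have inv: "disk_quot (disk_shift a u) (disk_shift a v) = disk_quot u v"
    if "norm u < 1" "norm v < 1" for u v
    using disk_shift_invariant[OF n(1) that] by (simp add: disk_quot_def)
  have "cosh (hyp_dist r x) = 1 + 2 * disk_quot 0 z"
    using cosh_hyp_dist[OF r x, folded a_def] inv[OF n(1,2)] by (simp add: a0 z_def)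
  note rx = cosh_sinh_disk_radius[OF zw(1) hyp_dist_nonneg[OF r x] this]
  have "cosh (hyp_dist r y) = 1 + 2 * disk_quot 0 w"
    using cosh_hyp_dist[OF r y, folded a_def] inv[OF n(1,3)] by (simp add: a0 w_def)
  note ry = cosh_sinh_disk_radius[OF zw(2) hyp_dist_nonneg[OF r y] this]
  have "cosh (hyp_dist x y) = 1 + 2 * disk_quot z w"
    using cosh_hyp_dist[OF x y] inv[OF n(2,3)] by (simp add: z_def w_def)
  also have "\<dots> = 1 + 2 * ((norm z)\<^sup>2 + (norm w)\<^sup>2 - 2 * (z \<bullet> w)) /
      ((1 - (norm z)\<^sup>2) * (1 - (norm w)\<^sup>2))"
    by (simp add: disk_quot_def power2_norm_eq_inner inner_diff_left inner_diff_right inner_commute)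
  \<comment> \<open>If \<open>z\<close> or \<open>w\<close> is 0, the corresponding direction is
    \<open>sgn 0 = 0\<close> and both sides vanish.\<close>
  also have "z \<bullet> w = norm z * norm w * (direction r x \<bullet> direction r y)"
    by (cases "z = 0"; cases "w = 0")
      (simp_all add: direction_def sgn_div_norm field_simps flip: a_def z_def w_def)
  also have "1 + 2 * ((norm z)\<^sup>2 + (norm w)\<^sup>2 - 2 * \<dots>) / ((1 - (norm z)\<^sup>2) * (1 - (norm w)\<^sup>2)) =
    cosh (hyp_dist r x) * cosh (hyp_dist r y) -
    sinh (hyp_dist r x) * sinh (hyp_dist r y) * (direction r x \<bullet> direction r y)"
  proof -
    have field: "1 + 2 * (p\<^sup>2 + q\<^sup>2 - 2 * (p * q * t)) / (P * Q) =
       (1 + p\<^sup>2) / P * ((1 + q\<^sup>2) / Q) - 2 * p / P * (2 * q / Q) * t"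
      if "P = 1 - p\<^sup>2" "Q = 1 - q\<^sup>2" "P > 0" "Q > 0" for p q t P Q :: real
    proof -
      have "P * Q + 2 * (p\<^sup>2 + q\<^sup>2 - 2 * (p * q * t)) = (1 + p\<^sup>2) * (1 + q\<^sup>2) - 2 * p * (2 * q) * t"
        unfolding that by (simp add: algebra_simps)
      thus ?thesis using that(3,4) by (simp add: divide_simps)
    qed
    show ?thesis unfolding rx ry
      by (rule field) (use zw in \<open>auto simp: power_less_one_iff\<close>)
  qed
  finally show ?thesis .
qed

text \<open>An angle has cosine at least -1, so the law of cosines bounds the left side by
  \<open>cosh (a + b)\<close>, with equality for opposite directions.\<close>

lemma hyp_dist_triangle:
  assumes r: "r \<in> poincare_disk" and x: "x \<in> poincare_disk" and y: "y \<in> poincare_disk"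
  shows "hyp_dist x y \<le> hyp_dist r x + hyp_dist r y"
proof -
  let ?a = "hyp_dist r x" and ?b = "hyp_dist r y"
  have nn: "?a \<ge> 0" "?b \<ge> 0" using assms by (auto intro: hyp_dist_nonneg)
  have "norm (direction r x) * norm (direction r y) \<le> 1 * 1"
    by (intro mult_mono norm_direction_le_1) auto
  hence "- (direction r x \<bullet> direction r y) \<le> 1"
    using Cauchy_Schwarz_ineq2[of "direction r x" "direction r y"] by linarith
  hence "sinh ?a * sinh ?b * - (direction r x \<bullet> direction r y) \<le> sinh ?a * sinh ?b * 1"
    using nn by (intro mult_left_mono) auto
  hence "cosh (hyp_dist x y) \<le> cosh (?a + ?b)"
    unfolding hyperbolic_law_of_cosines[OF assms] cosh_add by simp
  thus ?thesis using nn hyp_dist_nonneg[OF x y] by (simp add: cosh_real_nonneg_le_iff)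
qed

text \<open>With \<open>n\<close> the norm, \<open>exp d = (1 + n) / (1 - n)\<close>. Bounding this
  by \<open>1 / (1 - n) ^ 2\<close> costs a factor 2 but, unlike \<open>2 / (1 - n)\<close>, leaves
  no additive constant.\<close>

lemma point_bits_ge_hyp_dist:
  assumes "x \<in> poincare_disk"
  shows "point_bits x \<ge> hyp_dist 0 x / (2 * ln 2)"
proof -
  let ?n = "norm x" and ?d = "hyp_dist 0 x"
  have 0: "(0 :: real ^ 2) \<in> poincare_disk" by (simp add: poincare_disk_iff)
  have n: "0 \<le> ?n" "?n < 1" "?n\<^sup>2 < 1" using assms by (auto simp: poincare_disk_iff power_less_one_iff)
  have "to_complex 0 = 0" by (simp add: to_complex_def complex_eq_iff)
  hence "cosh ?d = 1 + 2 * disk_quot 0 (to_complex x)" using cosh_hyp_dist[OF 0 assms] by simp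
  from cosh_sinh_disk_radius[OF _ hyp_dist_nonneg[OF 0 assms] this]
  have "cosh ?d = (1 + ?n\<^sup>2) / (1 - ?n\<^sup>2)" "sinh ?d = 2 * ?n / (1 - ?n\<^sup>2)"
    using n by (auto simp: norm_to_complex)
  hence "exp ?d = (1 + ?n\<^sup>2) / (1 - ?n\<^sup>2) + 2 * ?n / (1 - ?n\<^sup>2)"
    using cosh_plus_sinh[of ?d] by simp
  also have "\<dots> = (1 + ?n) / (1 - ?n)"
  proof -
    have "1 - ?n\<^sup>2 = (1 - ?n) * (1 + ?n)" by (simp add: power2_eq_square algebra_simps)
    moreover have "1 + ?n\<^sup>2 + 2 * ?n = (1 + ?n) * (1 + ?n)" by (simp add: power2_eq_square algebra_simps)
    moreover have "1 + ?n > 0" "1 - ?n > 0" using n(1,2) by linarith+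
    ultimately show ?thesis by (simp flip: add_divide_distrib)
  qed
  also have "\<dots> = (1 + ?n) * (1 - ?n) / (1 - ?n)\<^sup>2"
    using n by (simp add: power2_eq_square)
  also have "\<dots> \<le> 1 / (1 - ?n)\<^sup>2"
    by (intro divide_right_mono) (simp_all add: algebra_simps)
  also have "\<dots> = (1 / (1 - ?n))\<^sup>2" by (simp add: power_divide)
  finally have "ln (exp ?d) \<le> ln ((1 / (1 - ?n))\<^sup>2)"
    using n by (subst ln_le_cancel_iff) auto
  hence "?d \<le> 2 * ln (1 / (1 - ?n))" using n by (simp add: ln_realpow)
  thus ?thesis by (simp add: point_bits_def log_def divide_simps)
qed

section \<open>Separated points around a centre\<close>

text \<open>Write \<open>sinh x\<close> as \<open>exp x * (1 - exp (- (2 * x))) / 2\<close>: the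
  first factor yields \<open>exp ((D - 1) * s)\<close>, convexity of \<open>exp\<close> yields
  \<open>D\<close> for the second. The bound thus covers small and large scales \<open>s\<close>
  alike.\<close>

lemma sinh_mult_le:
  fixes s D :: real
  assumes "s \<ge> 0" "D \<ge> 1"
  shows "sinh (D * s) \<le> D * exp ((D - 1) * s) * sinh s"
proof -
  have sinh: "sinh x = exp x * (1 - exp (- (2 * x))) / 2" for x :: real
    by (simp add: sinh_field_def algebra_simps flip: exp_add)
  \<comment> \<open>The point \<open>- (2 * s)\<close> lies between 0 and
    \<open>- (2 * (D * s))\<close> with weight \<open>1 / D\<close>.\<close>
  have "exp ((1 - 1 / D) *\<^sub>R 0 + (1 / D) *\<^sub>R (- (2 * (D * s)))) \<le>
      (1 - 1 / D) * exp 0 + 1 / D * exp (- (2 * (D * s)))"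
    using assms by (intro convex_onD[OF exp_convex]) auto
  also have "(1 - 1 / D) *\<^sub>R 0 + (1 / D) *\<^sub>R (- (2 * (D * s))) = - (2 * s)"
    using assms by simp
  finally have "D * exp (- (2 * s)) \<le> D * ((1 - 1 / D) * exp 0 + 1 / D * exp (- (2 * (D * s))))"
    using assms by (intro mult_left_mono) auto
  also have "\<dots> = D - 1 + exp (- (2 * (D * s)))"
    using assms by (simp add: algebra_simps)
  finally have "1 - exp (- (2 * (D * s))) \<le> D * (1 - exp (- (2 * s)))"
    by (simp add: algebra_simps)
  hence "exp (D * s) * (1 - exp (- (2 * (D * s)))) / 2 \<le>
      exp (D * s) * (D * (1 - exp (- (2 * s)))) / 2" by simp
  also have "\<dots> = D * exp ((D - 1) * s) * (exp s * (1 - exp (- (2 * s))) / 2)"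
    by (simp add: algebra_simps flip: exp_add)
  finally show ?thesis unfolding sinh[of s] sinh[of "D * s"] .
qed

lemma sinh_half_le: "x \<ge> 0 \<Longrightarrow> sinh (x / 2) \<le> sinh x / 2" for x :: real
proof -
  assume "x \<ge> 0"
  hence "sinh (x / 2) * 1 \<le> sinh (x / 2) * cosh (x / 2)"
    by (intro mult_left_mono cosh_real_ge_1) auto
  thus ?thesis using sinh_double[of "x / 2"] by simp
qed

text \<open>The law of cosines reads
  \<open>cosh d = cosh (a - b) + sinh a * sinh b * (1 - t)\<close>, with \<open>t\<close> the cosine
  of the angle at \<open>r\<close>; \<open>k\<close> controls the radial term and
  \<open>\<eta>\<close> the angular one. Separation \<open>2 * s\<close> makes the left side at
  least \<open>1 + 2 * (sinh s) ^ 2\<close>. After division by \<open>(sinh s) ^ 2\<close>, for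
  \<open>k\<close> below 1, a small \<open>\<eta>\<close> forces \<open>(D - 1) * s\<close> to be
  large.\<close>

lemma scale_bound_of_close_directions:
  assumes disk: "r \<in> poincare_disk" "x \<in> poincare_disk" "y \<in> poincare_disk"
    and s: "s > 0" and D: "D \<ge> 1"
    and rx: "s \<le> hyp_dist r x" "hyp_dist r x \<le> D * s"
    and ry: "s \<le> hyp_dist r y" "hyp_dist r y \<le> D * s"
    and xy: "2 * s \<le> hyp_dist x y"
    and k: "sinh (\<bar>hyp_dist r x - hyp_dist r y\<bar> / 2) \<le> k * sinh s"
    and \<eta>: "1 - direction r x \<bullet> direction r y \<le> \<eta>"
  shows "1 - k\<^sup>2 \<le> D\<^sup>2 * exp (2 * ((D - 1) * s)) * \<eta> / 2"
proof -
  let ?a = "hyp_dist r x" and ?b = "hyp_dist r y" and ?t = "direction r x \<bullet> direction r y"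
  have ss: "sinh s > 0" using s by simp
  have cosh2: "cosh (2 * u) = 1 + 2 * (sinh u)\<^sup>2" for u :: real
    by (simp add: cosh_double cosh_square_eq)
  have "norm (direction r x) * norm (direction r y) \<le> 1 * 1"
    by (intro mult_mono norm_direction_le_1) auto
  hence t: "1 - ?t \<ge> 0"
    using Cauchy_Schwarz_ineq2[of "direction r x" "direction r y"] by linarith
  have "1 + 2 * (sinh s)\<^sup>2 \<le> cosh (hyp_dist x y)"
    using xy s unfolding cosh2[symmetric] by (simp add: cosh_real_nonneg_le_iff)
  also have "\<dots> = cosh (?a - ?b) + sinh ?a * sinh ?b * (1 - ?t)"
    by (simp add: hyperbolic_law_of_cosines[OF disk] cosh_diff algebra_simps)
  also have "cosh (?a - ?b) = cosh (2 * (\<bar>?a - ?b\<bar> / 2))" by simp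
  also have "\<dots> \<le> 1 + 2 * (k * sinh s)\<^sup>2"
    unfolding cosh2 using power_mono[OF k, of 2] by simp
  also have "sinh ?a * sinh ?b * (1 - ?t) \<le> sinh (D * s) * sinh (D * s) * \<eta>"
    using rx ry s t D by (intro mult_mono \<eta>) (auto intro!: mult_nonneg_nonneg)
  also have "\<dots> \<le> (D * exp ((D - 1) * s) * sinh s) * (D * exp ((D - 1) * s) * sinh s) * \<eta>"
    using s D t \<eta> by (intro mult_right_mono mult_mono sinh_mult_le) auto
  also have "\<dots> = (sinh s)\<^sup>2 * (D\<^sup>2 * exp (2 * ((D - 1) * s)) * \<eta>)"
    by (simp add: power2_eq_square mult_exp_exp algebra_simps exp_double)
  finally have "(sinh s)\<^sup>2 * (2 * (1 - k\<^sup>2)) \<le> (sinh s)\<^sup>2 * (D\<^sup>2 * exp (2 * ((D - 1) * s)) * \<eta>)"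
    by (simp add: algebra_simps power_mult_distrib)
  hence "2 * (1 - k\<^sup>2) \<le> D\<^sup>2 * exp (2 * ((D - 1) * s)) * \<eta>"
    using ss by simp
  thus ?thesis by simp
qed

text \<open>The squared norm of \<open>u + v + w\<close> is nonnegative.\<close>
lemma three_unit_vectors:
  fixes u v w :: "'a :: real_inner"
  assumes "norm u = 1" "norm v = 1" "norm w = 1"
  shows "u \<bullet> v \<ge> - 1 / 2 \<or> u \<bullet> w \<ge> - 1 / 2 \<or> v \<bullet> w \<ge> - 1 / 2"
proof -
  have "u \<bullet> u = 1" "v \<bullet> v = 1" "w \<bullet> w = 1" using assms by (auto simp: norm_eq_1)
  moreover have "(u + v + w) \<bullet> (u + v + w) =
      u \<bullet> u + v \<bullet> v + w \<bullet> w + 2 * (u \<bullet> v) + 2 * (u \<bullet> w) + 2 * (v \<bullet> w)"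
    by (simp add: inner_add inner_commute)
  moreover have "(u + v + w) \<bullet> (u + v + w) \<ge> 0" by simp
  ultimately show ?thesis by linarith
qed

text \<open>Uses 1 - cos t = 2 * sin(t/2)^2. Across the branch cut of \<open>Arg\<close> the bound
  stays true, only weaker.\<close>

lemma one_minus_inner_unit_complex_le:
  fixes u v :: complex
  assumes "norm u = 1" "norm v = 1"
  shows "1 - u \<bullet> v \<le> (Arg u - Arg v)\<^sup>2 / 2"
proof -
  have "u = cis (Arg u)" "v = cis (Arg v)"
    using assms by (metis cis_Arg norm_zero sgn_eq zero_neq_one div_by_1 of_real_1)+
  hence "u \<bullet> v = cos (Arg u - Arg v)"
    by (metis cis.sel cos_diff inner_complex_def)
  also have "Arg u - Arg v = 2 * ((Arg u - Arg v) / 2)" by simp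
  also have "cos \<dots> = 1 - 2 * (sin ((Arg u - Arg v) / 2))\<^sup>2" by (rule cos_double_sin)
  finally have "1 - u \<bullet> v = 2 * \<bar>sin ((Arg u - Arg v) / 2)\<bar>\<^sup>2" by simp
  also have "\<dots> \<le> 2 * \<bar>(Arg u - Arg v) / 2\<bar>\<^sup>2"
    by (intro mult_left_mono power_mono abs_sin_x_le_abs_x) auto
  finally show ?thesis by (simp add: power2_eq_square)
qed

section \<open>Pigeonhole on radius and direction, and the resulting scale bound\<close>

lemma abs_diff_less_1_of_floor_eq:
  fixes u v :: real
  shows "\<lfloor>u\<rfloor> = \<lfloor>v\<rfloor> \<Longrightarrow> \<bar>u - v\<bar> < 1"
  by linarith

text \<open>Indices are classed by radius in units of \<open>s\<close> and by sector of width
  \<open>2 * pi / N\<close>. The radius floors start at 1, giving at most \<open>D\<close> classes;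
  the sector floors start at 0, giving at most \<open>N + 1\<close>.\<close>

lemma pigeonhole_radius_direction:
  fixes a :: "nat \<Rightarrow> real" and v :: "nat \<Rightarrow> complex" and s D N :: real
  assumes s: "s > 0" and N: "N > 0" and n: "D * (N + 1) < real n" and D: "D \<ge> 1"
    and a: "\<And>i. i < n \<Longrightarrow> s \<le> a i \<and> a i \<le> D * s"
    and v: "\<And>i. i < n \<Longrightarrow> norm (v i) = 1"
  obtains i j where "i < n" "j < n" "i \<noteq> j" "\<bar>a i - a j\<bar> \<le> s"
    "1 - v i \<bullet> v j \<le> 2 * pi\<^sup>2 / N\<^sup>2"
proof -
  define g where "g i = N * (Arg (v i) + pi) / (2 * pi)" for i
  define h where "h i = (\<lfloor>a i / s\<rfloor>, \<lfloor>g i\<rfloor>)" for i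
  have "h ` {..<n} \<subseteq> {1..\<lfloor>D\<rfloor>} \<times> {0..\<lfloor>N\<rfloor>}"
  proof (rule image_subsetI)
    fix i assume "i \<in> {..<n}"
    hence i: "i < n" by simp
    have "1 \<le> a i / s" "a i / s \<le> D" using a[OF i] s by (auto simp: field_simps)
    moreover from this have "\<lfloor>a i / s\<rfloor> \<le> \<lfloor>D\<rfloor>" by (intro floor_mono)
    moreover have "0 \<le> Arg (v i) + pi" "Arg (v i) + pi \<le> 2 * pi"
      using Arg_bounded[of "v i"] by linarith+
    hence "0 \<le> N * (Arg (v i) + pi)" "N * (Arg (v i) + pi) \<le> N * (2 * pi)"
      using N by (auto intro!: mult_left_mono)
    hence "0 \<le> g i" "g i \<le> N" by (auto simp: g_def divide_le_eq)
    moreover from this have "\<lfloor>g i\<rfloor> \<le> \<lfloor>N\<rfloor>" by (intro floor_mono)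
    ultimately show "h i \<in> {1..\<lfloor>D\<rfloor>} \<times> {0..\<lfloor>N\<rfloor>}" by (simp add: h_def)
  qed
  hence "card (h ` {..<n}) \<le> card ({1..\<lfloor>D\<rfloor>} \<times> {0..\<lfloor>N\<rfloor>})"
    by (intro card_mono) auto
  also have "real \<dots> = of_int \<lfloor>D\<rfloor> * (of_int \<lfloor>N\<rfloor> + 1)"
    using D N by (simp add: card_cartesian_product)
  also have "\<dots> \<le> D * (N + 1)"
    using D N by (intro mult_mono) auto
  also note n
  finally have "card (h ` {..<n}) < card {..<n}" by simp
  then obtain i j where ij: "i < n" "j < n" "i \<noteq> j" "h i = h j"
    using pigeonhole[of h "{..<n}"] by (auto simp: inj_on_def)
  have "\<bar>a i / s - a j / s\<bar> < 1" "\<bar>g i - g j\<bar> < 1"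
    using ij(4) by (auto simp: h_def intro!: abs_diff_less_1_of_floor_eq)
  hence "\<bar>a i - a j\<bar> \<le> s" and g: "\<bar>g i - g j\<bar> \<le> 1"
    using s by (auto simp: abs_if field_simps split: if_splits)
  have "Arg (v i) - Arg (v j) = 2 * pi / N * (g i - g j)"
    using N by (simp add: g_def field_simps)
  hence "\<bar>Arg (v i) - Arg (v j)\<bar> = 2 * pi / N * \<bar>g i - g j\<bar>"
    using N by (simp add: abs_mult)
  also have "\<dots> \<le> 2 * pi / N * 1" using N g by (intro mult_left_mono) auto
  finally have "\<bar>Arg (v i) - Arg (v j)\<bar>\<^sup>2 \<le> (2 * pi / N)\<^sup>2" by (intro power_mono) auto
  hence "1 - v i \<bullet> v j \<le> (2 * pi / N)\<^sup>2 / 2"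
    using one_minus_inner_unit_complex_le[of "v i" "v j"] v ij(1,2) by fastforce
  hence "1 - v i \<bullet> v j \<le> 2 * pi\<^sup>2 / N\<^sup>2" by (simp add: power_divide power_mult_distrib)
  thus ?thesis using that ij \<open>\<bar>a i - a j\<bar> \<le> s\<close> by blast
qed

text \<open>Close directions come from three unit vectors for small \<open>n\<close> and from the
  pigeonhole for large \<open>n\<close>. Below the threshold \<open>10 ^ 8\<close> the exponent
  \<open>1 / 10000\<close> keeps \<open>\<epsilon>\<close> under \<open>1 / 100\<close>; above it
  the eighth root of \<open>n\<close> is at least 10, which absorbs all constants.\<close>

lemma star_scale_bound:
  fixes s \<epsilon> :: real and n :: nat
  assumes n: "3 \<le> n" and s: "s > 0" and \<epsilon>: "\<epsilon> > 0"
    and D: "1 + \<epsilon> \<le> real n powr (1 / 10000)"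
    and r: "r \<in> poincare_disk" and x: "\<And>i. i < n \<Longrightarrow> x i \<in> poincare_disk"
    and rx: "\<And>i. i < n \<Longrightarrow> s \<le> hyp_dist r (x i) \<and> hyp_dist r (x i) \<le> (1 + \<epsilon>) * s"
    and xx: "\<And>i j. i < n \<Longrightarrow> j < n \<Longrightarrow> i \<noteq> j \<Longrightarrow> 2 * s \<le> hyp_dist (x i) (x j)"
  shows "ln n / 500 \<le> s * \<epsilon>"
proof -
  have xr: "x i \<noteq> r" if "i < n" for i
    using rx[OF that] s by (auto simp: hyp_dist_def)
  have v: "norm (direction r (x i)) = 1" if "i < n" for i
    using that by (intro norm_direction x r xr)
  have ln10: "ln (10 :: real) \<le> 3"
  proof -
    \<comment> \<open>(3/2)^6 = 729/64 exceeds 10.\<close>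
    have "(10 :: real) \<le> (1 + 1 / 2) ^ 6" by (simp add: power_divide)
    also have "\<dots> \<le> exp (1 / 2) ^ 6" by (intro power_mono exp_ge_add_one_self) auto
    also have "\<dots> = exp 3" by (simp flip: exp_of_nat_mult)
    finally have "ln 10 \<le> ln (exp 3 :: real)" by (intro ln_mono) auto
    thus ?thesis by simp
  qed
  have ln108: "ln ((10 :: real) ^ 8) = 8 * ln 10" by (subst ln_realpow) auto
  show ?thesis
  proof (cases "n < 10 ^ 8")
    case True
    \<comment> \<open>\<open>\<epsilon>\<close> is tiny, so an angle of at most 120 degrees between two points already suffices.\<close>
    have "1 + \<epsilon> \<le> (10 ^ 8) powr (1 / 10000)"
      using D True n by (elim order.trans) (intro powr_mono2, auto)
    also have "\<dots> = exp (ln (10 ^ 8) / 10000)" by (simp add: powr_def)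
    also have "\<dots> = exp (8 * ln 10 / 10000)" unfolding ln108 ..
    also have "\<dots> \<le> exp (24 / 10000)" using ln10 by simp
    also have "\<dots> \<le> 1 + 24 / 10000 + (24 / 10000)\<^sup>2" by (rule exp_bound) auto
    also have "\<dots> \<le> 101 / 100" by (simp add: power2_eq_square)
    finally have \<epsilon>1: "\<epsilon> \<le> 1 / 100" by simp
    have "\<exists>i j. i < n \<and> j < n \<and> i \<noteq> j \<and> - 1 / 2 \<le> direction r (x i) \<bullet> direction r (x j)"
    proof -
      let ?v = "\<lambda>i. direction r (x i)"
      consider "- 1 / 2 \<le> ?v 0 \<bullet> ?v 1" | "- 1 / 2 \<le> ?v 0 \<bullet> ?v 2" | "- 1 / 2 \<le> ?v 1 \<bullet> ?v 2"
        using three_unit_vectors[OF v[of 0] v[of 1] v[of 2]] n by auto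
      thus ?thesis
      proof cases
        case 1
        thus ?thesis using n by (intro exI[of _ 0] exI[of _ 1]) auto
      next
        case 2
        thus ?thesis using n by (intro exI[of _ 0] exI[of _ 2]) auto
      next
        case 3
        thus ?thesis using n by (intro exI[of _ 1] exI[of _ 2]) auto
      qed
    qed
    then obtain i j where ij: "i < n" "j < n" "i \<noteq> j"
      "1 - direction r (x i) \<bullet> direction r (x j) \<le> 3 / 2" by force
    let ?a = "hyp_dist r (x i)" and ?b = "hyp_dist r (x j)"
    have "\<bar>?a - ?b\<bar> \<le> \<epsilon> * s" using rx[OF ij(1)] rx[OF ij(2)] by (auto simp: algebra_simps)
    also have "\<dots> \<le> 1 / 2 * s" using \<epsilon>1 s by (intro mult_right_mono) auto
    finally have "sinh (\<bar>?a - ?b\<bar> / 2) \<le> sinh (s / 2 / 2)" by simp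
    \<comment> \<open>Halving once would not suffice: \<open>k = 1 / 2\<close> gives 3/4 on the
      left, which the angular factor 3/4 on the right matches already at scale 0.\<close>
    also have "\<dots> \<le> 1 / 4 * sinh s"
      using sinh_half_le[of "s / 2"] sinh_half_le[of s] s by simp
    finally have "1 - (1 / 4)\<^sup>2 \<le>
        (1 + \<epsilon>)\<^sup>2 * exp (2 * ((1 + \<epsilon> - 1) * s)) * (3 / 2) / 2"
      using ij s \<epsilon> rx xx x r by (intro scale_bound_of_close_directions[of r "x i" "x j"]) auto
    also have "(1 + \<epsilon>)\<^sup>2 \<le> (101 / 100)\<^sup>2" using \<epsilon> \<epsilon>1 by (intro power_mono) auto
    \<comment> \<open>The quotient of 15/16 by (101/100)^2 * 3/4 is still above 6/5.\<close>
    finally have "1 + 1 / 5 \<le> exp (2 * (\<epsilon> * s))" by (simp add: power2_eq_square)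
    moreover have "exp (1 / 10) \<le> 1 + 1 / 10 + (1 / 10 :: real)\<^sup>2" by (rule exp_bound) auto
    moreover have "1 + 1 / 10 + (1 / 10 :: real)\<^sup>2 \<le> 1 + 1 / 5" by (simp add: power2_eq_square)
    ultimately have "exp (1 / 10) \<le> exp (2 * (\<epsilon> * s))" by linarith
    hence "1 / 10 \<le> 2 * (\<epsilon> * s)" unfolding exp_le_cancel_iff .
    hence "1 / 20 \<le> s * \<epsilon>" by (simp add: mult.commute)
    moreover have "ln n \<le> ln (10 ^ 8 :: real)" using n True by (intro ln_mono) auto
    hence "ln n \<le> 8 * ln (10 :: real)" unfolding ln108 .
    \<comment> \<open>Here \<open>ln n\<close> is at most 24, and 24/500 is below 1/20; this fixes
      the constant 500.\<close>
    ultimately show ?thesis using ln10 by linarith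
  next
    case False
    \<comment> \<open>\<open>1 + \<epsilon>\<close> is a small power of \<open>n\<close>, so after sorting the points by radius there are
      still enough of them in one class to force an angle of order \<open>1 / sqrt n\<close>.\<close>
    hence n8: "real n \<ge> 10 ^ 8" by (simp flip: of_nat_le_iff)
    have D4: "1 + \<epsilon> \<le> n powr (1 / 8)" using n8 by (intro order.trans[OF D] powr_mono) auto
    \<comment> \<open>Integer powers of \<open>q\<close> replace fractional powers of
      \<open>n\<close>. The pigeonhole below uses \<open>N = q ^ 4 / 2\<close>, half the square root
      of \<open>n\<close>, and at most \<open>q\<close> radius classes.\<close>
    define q where "q = real n powr (1 / 8)"
    have q8: "q ^ 8 = n" using n8 by (auto simp: q_def powr_power)
    have q: "q \<ge> 10"
      by (rule power_le_imp_le_base[of _ 7]) (use n8 q8 in \<open>auto simp: q_def\<close>)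
    have q_le: "1 + \<epsilon> \<le> q" using D4 by (simp add: q_def)
    have "(1 + \<epsilon>) * (q ^ 4 / 2 + 1) \<le> q * (q ^ 4 / 2 + 1)"
      using q_le q by (intro mult_right_mono) auto
    also have "\<dots> < q * q ^ 7" 
    proof -
      have "1000 \<le> q ^ 3" using power_mono[OF q, of 3] by simp
      hence "q ^ 4 * 1000 \<le> q ^ 4 * q ^ 3" using q by (intro mult_left_mono) auto
      moreover have "10 ^ 4 \<le> q ^ 4" using power_mono[OF q, of 4] by simp
      ultimately have "q ^ 4 / 2 + 1 < q ^ 7" by (simp flip: power_add)
      thus ?thesis using q by simp
    qed
    also have "\<dots> = n" using q8 by (simp flip: power_Suc)
    finally have "(1 + \<epsilon>) * (q ^ 4 / 2 + 1) < n" .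
    with s \<epsilon> q obtain i j where ij: "i < n" "j < n" "i \<noteq> j"
        "\<bar>hyp_dist r (x i) - hyp_dist r (x j)\<bar> \<le> s"
        "1 - direction r (x i) \<bullet> direction r (x j) \<le> 2 * pi\<^sup>2 / (q ^ 4 / 2)\<^sup>2"
      using pigeonhole_radius_direction[of s "q ^ 4 / 2" "1 + \<epsilon>" n "\<lambda>i. hyp_dist r (x i)"
          "\<lambda>i. direction r (x i)"] rx v by (smt (verit) divide_pos_pos zero_less_power)
    let ?a = "hyp_dist r (x i)" and ?b = "hyp_dist r (x j)"
    have "sinh (\<bar>?a - ?b\<bar> / 2) \<le> sinh (s / 2)" using ij by simp
    also have "\<dots> \<le> 1 / 2 * sinh s" using sinh_half_le[of s] s by simp
    finally have "1 - (1 / 2)\<^sup>2 \<le>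
        (1 + \<epsilon>)\<^sup>2 * exp (2 * ((1 + \<epsilon> - 1) * s)) * (2 * pi\<^sup>2 / (q ^ 4 / 2)\<^sup>2) / 2"
      using ij s \<epsilon> rx xx x r by (intro scale_bound_of_close_directions[of r "x i" "x j"]) auto
    also have "\<dots> = (1 + \<epsilon>)\<^sup>2 * (exp (2 * (\<epsilon> * s)) * (4 * pi\<^sup>2 / q ^ 8))"
      by (simp add: power_divide flip: power_mult)
    also have "\<dots> \<le> q\<^sup>2 * (exp (2 * (\<epsilon> * s)) * (4 * 4\<^sup>2 / q ^ 8))"
      using q_le q \<epsilon> pi_less_4
      by (intro mult_mono power_mono divide_right_mono mult_left_mono) auto
    also have "\<dots> = exp (2 * (\<epsilon> * s)) * 64 / q ^ 6"
    proof -
      have cancel: "u * (E * (4 * 4\<^sup>2 / w)) = E * 64 / t" if "w = u * t" "u \<noteq> 0" for u t w E :: real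
        using that by simp
      show ?thesis by (rule cancel) (use q in \<open>simp_all flip: power_add\<close>)
    qed
    finally have *: "3 / 4 * q ^ 6 \<le> exp (2 * (\<epsilon> * s)) * 64" using q by (simp add: field_simps)
    have "100000 \<le> q ^ 5" using power_mono[OF q, of 5] by simp
    hence "100000 * q \<le> q ^ 5 * q" using q by (intro mult_right_mono) auto
    also have "q ^ 5 * q = q ^ 6" by (simp flip: power_Suc2)
    \<comment> \<open>Five of the six powers of \<open>q\<close> swallow the constant 256/3, leaving
      one.\<close>
    finally have "q \<le> exp (2 * (\<epsilon> * s))" using * q by linarith
    hence "ln q \<le> ln (exp (2 * (\<epsilon> * s)))" using q by (intro ln_mono) auto
    hence "ln q \<le> 2 * (\<epsilon> * s)" unfolding ln_exp .
    moreover have "ln q = ln n / 8" using n8 by (simp add: q_def ln_powr)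
    moreover have "ln n \<ge> 0" using n8 by (intro ln_ge_zero) simp
    ultimately show ?thesis by (simp add: mult.commute)
  qed
qed

section \<open>Graph distances and distortion\<close>

lemma graph_dist_le_length:
  assumes "wf_digraph G" and walk: "pre_digraph.awalk G u p v"
  shows "graph_dist G u v \<le> length p"
proof -
  interpret wf_digraph G by fact
  have "\<mu> (\<lambda>_. 1) u v \<le> ereal (length p)"
    using min_cost_le_walk_cost[OF walk, of "\<lambda>_. 1"] by (simp add: awalk_cost_def sum_list_triv)
  \<comment> \<open>The walk rules out plus infinity; at minus infinity \<open>real_of_ereal\<close>
    returns 0, which respects the bound.\<close>
  thus ?thesis unfolding graph_dist_def by (cases "\<mu> (\<lambda>_. 1) u v") auto
qed

text \<open>Reachability keeps the infimum below infinity, which \<open>real_of_ereal\<close> would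
  turn into 0.\<close>

lemma graph_dist_ge:
  assumes "wf_digraph G" and reach: "u \<rightarrow>\<^sup>*\<^bsub>G\<^esub> v"
    and le: "\<And>p. pre_digraph.awalk G u p v \<Longrightarrow> k \<le> real (length p)"
  shows "k \<le> graph_dist G u v"
proof -
  interpret wf_digraph G by fact
  have "ereal k \<le> \<mu> (\<lambda>_. 1) u v"
    unfolding \<mu>_def by (intro INF_greatest) (simp add: awalk_cost_def sum_list_triv le)
  moreover have "\<mu> (\<lambda>_. 1) u v < \<infinity>" using reach unfolding \<mu>_reach_conv .
  ultimately show ?thesis unfolding graph_dist_def by (cases "\<mu> (\<lambda>_. 1) u v") auto
qed

lemma graph_dist_ge_1:
  assumes wf: "wf_digraph G" and "u \<rightarrow>\<^sup>*\<^bsub>G\<^esub> v" "u \<noteq> v"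
  shows "1 \<le> graph_dist G u v"
proof (rule graph_dist_ge[OF assms(1,2)])
  interpret wf_digraph G by (rule wf)
  fix p assume "awalk u p v"
  thus "1 \<le> real (length p)" using assms(3) by (cases p) (auto simp: awalk_Nil_iff)
qed

text \<open>A potential growing by at most 1 per arc certifies a lower bound on every walk, without
  any description of the walks.\<close>

lemma potential_le_length:
  fixes h :: "'a \<Rightarrow> int"
  assumes wf: "wf_digraph G"
    and lip: "\<And>e. e \<in> arcs G \<Longrightarrow> h (head G e) \<le> h (tail G e) + 1"
    and "pre_digraph.awalk G u p v"
  shows "h v \<le> h u + int (length p)"
  using assms(3)
proof (induct p arbitrary: u)
  interpret wf_digraph G by (rule wf)
  case Nil
  thus ?case by (simp add: awalk_Nil_iff)
next
  interpret wf_digraph G by (rule wf)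
  case (Cons e p)
  thus ?case using lip[of e] by (force simp: awalk_Cons_iff)
qed

text \<open>The scale \<open>s\<close> is the minimal ratio: positive because \<open>f\<close> is
  injective and the ratio set is finite, and nonempty thanks to \<open>a\<close> and
  \<open>b\<close>.\<close>

lemma ratio_bounds:
  assumes fin: "finite (verts G)" and disk: "disk_embedding G f"
    and pos: "\<And>u v. u \<in> verts G \<Longrightarrow> v \<in> verts G \<Longrightarrow> u \<noteq> v \<Longrightarrow> graph_dist G u v > 0"
    and ab: "a \<in> verts G" "b \<in> verts G" "a \<noteq> b"
    and D: "wc_distortion G f \<le> D"
  obtains s where "s > 0"
    "\<And>u v. u \<in> verts G \<Longrightarrow> v \<in> verts G \<Longrightarrow> u \<noteq> v \<Longrightarrow>
      s * graph_dist G u v \<le> hyp_dist (f u) (f v) \<and>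
      hyp_dist (f u) (f v) \<le> D * s * graph_dist G u v"
proof -
  let ?R = "dist_ratios G f"
  have "?R \<subseteq> (\<lambda>(u, v). hyp_dist (f u) (f v) / graph_dist G u v) ` (verts G \<times> verts G)"
    by (auto simp: dist_ratios_def)
  hence finR: "finite ?R" by (rule finite_subset) (use fin in auto)
  have R: "hyp_dist (f u) (f v) / graph_dist G u v \<in> ?R"
    if "u \<in> verts G" "v \<in> verts G" "u \<noteq> v" for u v
    using that by (auto simp: dist_ratios_def)
  hence ne: "?R \<noteq> {}" using ab by blast
  have "x > 0" if "x \<in> ?R" for x
  proof -
    from that obtain u v where uv: "u \<in> verts G" "v \<in> verts G" "u \<noteq> v"
      and x: "x = hyp_dist (f u) (f v) / graph_dist G u v" by (auto simp: dist_ratios_def)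
    have "f u \<noteq> f v" using disk uv by (auto simp: disk_embedding_def dest: inj_onD)
    hence "hyp_dist (f u) (f v) > 0"
      using disk uv by (intro hyp_dist_pos) (auto simp: disk_embedding_def)
    thus ?thesis using pos[OF uv] by (simp add: x)
  qed
  hence s: "Min ?R > 0" using finR ne by simp
  have M: "Max ?R \<le> D * Min ?R"
    using D s by (simp add: wc_distortion_def divide_le_eq)
  show ?thesis
  proof (rule that[OF s])
    fix u v assume uv: "u \<in> verts G" "v \<in> verts G" "u \<noteq> v"
    have "Min ?R \<le> hyp_dist (f u) (f v) / graph_dist G u v"
      "hyp_dist (f u) (f v) / graph_dist G u v \<le> D * Min ?R"
      using Min_le[OF finR R[OF uv]] Max_ge[OF finR R[OF uv]] M by auto
    thus "Min ?R * graph_dist G u v \<le> hyp_dist (f u) (f v) \<and>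
        hyp_dist (f u) (f v) \<le> D * Min ?R * graph_dist G u v"
      using pos[OF uv] by (simp add: field_simps)
  qed
qed

section \<open>The tree of chains\<close>

text \<open>Treating \<open>Root\<close> as node 0 of every chain merges the two families of edges
  into one.\<close>

definition chain_node :: "nat \<Rightarrow> nat \<Rightarrow> chain_vertex" where
  "chain_node i j = (if j = 0 then Root else Chain i j)"

lemma chain_tree_edges_eq:
  "chain_tree_edges m \<Delta> =
    {(chain_node i j, chain_node i (Suc j)) | i j. i < \<Delta> \<and> j < m}" (is "_ = ?R")
proof
  show "chain_tree_edges m \<Delta> \<subseteq> ?R"
    unfolding chain_tree_edges_def chain_node_def by fastforce
  show "?R \<subseteq> chain_tree_edges m \<Delta>"
    unfolding chain_tree_edges_def chain_node_def by auto
qed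

section \<open>Vertices, arcs, connectivity and distances of the tree\<close>

lemma verts_chain_tree:
  "verts (chain_tree m \<Delta>) = insert Root ((\<lambda>(i, j). Chain i j) ` ({..<\<Delta>} \<times> {1..m}))"
  by (auto simp: chain_tree_def)

lemma arcs_chain_tree: "arcs (chain_tree m \<Delta>) = chain_tree_edges m \<Delta> \<union> (chain_tree_edges m \<Delta>)\<inverse>"
  and tail_chain_tree: "tail (chain_tree m \<Delta>) = fst"
  and head_chain_tree: "head (chain_tree m \<Delta>) = snd"
  by (auto simp: chain_tree_def)

lemma chain_node_in_verts: "i < \<Delta> \<Longrightarrow> j \<le> m \<Longrightarrow> chain_node i j \<in> verts (chain_tree m \<Delta>)"
  by (auto simp: verts_chain_tree chain_node_def)

lemma arcs_chain_treeE:
  assumes "e \<in> arcs (chain_tree m \<Delta>)"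
  obtains i j where "i < \<Delta>" "j < m" "e = (chain_node i j, chain_node i (Suc j))"
  | i j where "i < \<Delta>" "j < m" "e = (chain_node i (Suc j), chain_node i j)"
  using assms unfolding arcs_chain_tree chain_tree_edges_eq by blast

lemma graph_chain_tree: "graph (chain_tree m \<Delta>)"
proof -
  have fin: "finite (verts (chain_tree m \<Delta>))" by (simp add: verts_chain_tree)
  have wf: "fst e \<in> verts (chain_tree m \<Delta>) \<and> snd e \<in> verts (chain_tree m \<Delta>)"
    if "e \<in> arcs (chain_tree m \<Delta>)" for e
    using that by (elim arcs_chain_treeE) (auto intro!: chain_node_in_verts)
  hence "arcs (chain_tree m \<Delta>) \<subseteq> verts (chain_tree m \<Delta>) \<times> verts (chain_tree m \<Delta>)"
    by (auto simp: mem_Times_iff)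
  hence fina: "finite (arcs (chain_tree m \<Delta>))" using fin by (meson finite_SigmaI finite_subset)
  show ?thesis
  proof
    show "symmetric (chain_tree m \<Delta>)"
      unfolding symmetric_def by (simp add: chain_tree_def sym_Un_converse)
    show "tail (chain_tree m \<Delta>) e \<noteq> head (chain_tree m \<Delta>) e" if "e \<in> arcs (chain_tree m \<Delta>)" for e
      using that
      by (elim arcs_chain_treeE) (auto simp: tail_chain_tree head_chain_tree chain_node_def)
  qed (use wf fin fina in \<open>auto simp: tail_chain_tree head_chain_tree arc_to_ends_def\<close>)
qed

lemma chain_tree_adj:
  "i < \<Delta> \<Longrightarrow> j < m \<Longrightarrow> (chain_node i j, chain_node i (Suc j)) \<in> arcs (chain_tree m \<Delta>)"
  unfolding arcs_chain_tree chain_tree_edges_eq by blast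

lemma chain_tree_reachable:
  assumes "u \<in> verts (chain_tree m \<Delta>)" "v \<in> verts (chain_tree m \<Delta>)"
  shows "u \<rightarrow>\<^sup>*\<^bsub>chain_tree m \<Delta>\<^esub> v"
proof -
  interpret graph "chain_tree m \<Delta>" by (rule graph_chain_tree)
  have root: "Root \<rightarrow>\<^sup>*\<^bsub>chain_tree m \<Delta>\<^esub> chain_node i j" if "i < \<Delta>" "j \<le> m" for i j
    using that(2)
  proof (induct j)
    case 0
    show ?case by (auto simp: chain_node_def verts_chain_tree)
  next
    case (Suc j)
    have "chain_node i j \<rightarrow>\<^bsub>chain_tree m \<Delta>\<^esub> chain_node i (Suc j)"
      using in_arcs_imp_in_arcs_ends[OF chain_tree_adj[OF that(1), of j]] Suc
      by (simp add: tail_chain_tree head_chain_tree)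
    with Suc show ?case by (meson Suc_leD reachable_adjI reachable_trans)
  qed
  have root: "Root \<rightarrow>\<^sup>*\<^bsub>chain_tree m \<Delta>\<^esub> w" if w: "w \<in> verts (chain_tree m \<Delta>)" for w
  proof (cases w)
    case Root
    thus ?thesis using w by auto
  next
    case (Chain i j)
    thus ?thesis using w root[of i j] by (auto simp: verts_chain_tree chain_node_def)
  qed
  show ?thesis using symmetric_reachable'[OF root[OF assms(1)]] root[OF assms(2)]
    by (rule reachable_trans)
qed

lemma chain_tree_dist_ge:
  assumes u: "Chain i j \<in> verts (chain_tree m \<Delta>)" and v: "Chain k l \<in> verts (chain_tree m \<Delta>)"
    and ik: "i \<noteq> k"
  shows "real (j + l) \<le> graph_dist (chain_tree m \<Delta>) (Chain i j) (Chain k l)"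
proof -
  interpret graph "chain_tree m \<Delta>" by (rule graph_chain_tree)
  show ?thesis
  proof (rule graph_dist_ge[OF wf_digraph_axioms chain_tree_reachable[OF u v]])
    fix p assume p: "awalk (Chain i j) p (Chain k l)"
    \<comment> \<open>A signed height: up along chain \<open>k\<close>, down along all the others, 0
      at the root. The endpoints differ in height by \<open>j + l\<close>.\<close>
    define h where "h w = (case w of Root \<Rightarrow> 0 | Chain i j \<Rightarrow> if i = k then int j else - int j)" for w
    have node: "h (chain_node i j) = (if i = k then int j else - int j)" for i j
      by (simp add: h_def chain_node_def)
    have "h (Chain k l) \<le> h (Chain i j) + int (length p)"
      by (rule potential_le_length[OF wf_digraph_axioms _ p], erule arcs_chain_treeE)
        (simp_all add: tail_chain_tree head_chain_tree node)
    thus "real (j + l) \<le> real (length p)" using ik by (simp add: h_def)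
  qed
qed

lemma chain_tree_dist_root:
  assumes "i < \<Delta>" "1 \<le> m"
  shows "graph_dist (chain_tree m \<Delta>) Root (Chain i 1) = 1"
proof (rule antisym)
  interpret graph "chain_tree m \<Delta>" by (rule graph_chain_tree)
  have arc: "(Root, Chain i 1) \<in> arcs (chain_tree m \<Delta>)"
    using chain_tree_adj[of i \<Delta> 0 m] assms by (simp add: chain_node_def)
  have "awalk Root [(Root, Chain i 1)] (Chain i 1)"
    using arc_implies_awalk[OF arc] by (simp add: tail_chain_tree head_chain_tree)
  from graph_dist_le_length[OF wf_digraph_axioms this]
  show "graph_dist (chain_tree m \<Delta>) Root (Chain i 1) \<le> 1" by simp
  show "1 \<le> graph_dist (chain_tree m \<Delta>) Root (Chain i 1)"
    using assms by (intro graph_dist_ge_1 wf_digraph_axioms chain_tree_reachable) (auto simp: verts_chain_tree)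
qed

section \<open>Longest path, maximum degree and size of the tree\<close>

primrec chain_index :: "chain_vertex \<Rightarrow> nat" where
  "chain_index Root = 0"
| "chain_index (Chain i j) = i"

text \<open>Arcs that miss \<open>Root\<close> stay within one chain.\<close>

lemma chain_index_walk_avoiding_Root:
  assumes "pre_digraph.awalk (chain_tree m \<Delta>) u p v"
    "Root \<notin> set (pre_digraph.awalk_verts (chain_tree m \<Delta>) u p)"
  shows "chain_index u = chain_index v"
  using assms
proof (induct p arbitrary: u)
  interpret graph "chain_tree m \<Delta>" by (rule graph_chain_tree)
  case Nil
  thus ?case by (simp add: awalk_Nil_iff)
next
  interpret graph "chain_tree m \<Delta>" by (rule graph_chain_tree)
  case (Cons e p)
  hence e: "e \<in> arcs (chain_tree m \<Delta>)" "fst e = u" "awalk (snd e) p v"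
    by (auto simp: awalk_Cons_iff tail_chain_tree head_chain_tree)
  moreover have "Root \<notin> set (awalk_verts (snd e) p)" "u \<noteq> Root"
    using Cons.prems(2) e(2) by (auto simp: tail_chain_tree head_chain_tree)
  moreover from this have "snd e \<noteq> Root" using hd_in_awalk_verts(1)[OF e(3)] by auto
  ultimately have "chain_index u = chain_index (snd e)"
    by (auto elim!: arcs_chain_treeE simp: chain_node_def split: if_splits)
  thus ?case using Cons.hyps e(3) \<open>Root \<notin> set (awalk_verts (snd e) p)\<close> by simp
qed

text \<open>A path passes \<open>Root\<close> at most once, so before it the path stays in the chain
  of \<open>u\<close> and after it in the chain of \<open>v\<close>. It therefore visits at most
  \<open>2 * m + 1\<close> vertices.\<close>

lemma chain_tree_apath_length:
  assumes "pre_digraph.apath (chain_tree m \<Delta>) u p v"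
  shows "length p \<le> 2 * m"
proof -
  interpret graph "chain_tree m \<Delta>" by (rule graph_chain_tree)
  let ?C = "\<lambda>i. Chain i ` {1..m}"
  have p: "awalk u p v" "distinct (awalk_verts u p)" using assms by (auto simp: apath_def)
  \<comment> \<open>If an endpoint is \<open>Root\<close>, its dummy index 0 merely adds chain 0 to
    the covering set.\<close>
  have "set (awalk_verts u p) \<subseteq> insert Root (?C (chain_index u) \<union> ?C (chain_index v))"
  proof
    fix x assume x: "x \<in> set (awalk_verts u p)"
    then obtain q r where qr: "p = q @ r" "awalk u q x" "awalk x r v"
      using awalk_decomp[OF p(1)] by blast
    have "x \<in> verts (chain_tree m \<Delta>)" using qr(2) by (rule awalk_last_in_verts)
    moreover have "chain_index x = chain_index u \<or> chain_index x = chain_index v" if "x \<noteq> Root"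
    proof (cases "Root \<in> set (awalk_verts u q)")
      case True
      have "awalk_verts x r = x # tl (awalk_verts x r)"
        using qr(3) by (metis awalkE awalk_verts_non_Nil list.collapse)
      \<comment> \<open>\<open>Root\<close> was met on the way to \<open>x\<close>, so distinctness
        excludes it afterwards; the tail drops \<open>x\<close>, which both pieces share.\<close>
      moreover have "Root \<notin> set (tl (awalk_verts x r))"
        using apath_decomp_disjoint[OF assms qr(1) True] qr(2) by auto
      ultimately have "Root \<notin> set (awalk_verts x r)" using that by (metis set_ConsD)
      thus ?thesis using chain_index_walk_avoiding_Root[OF qr(3)] by simp
    next
      case False
      thus ?thesis using chain_index_walk_avoiding_Root[OF qr(2)] by simp
    qed
    ultimately show "x \<in> insert Root (?C (chain_index u) \<union> ?C (chain_index v))"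
      by (auto simp: verts_chain_tree)
  qed
  hence "card (set (awalk_verts u p)) \<le>
      card (insert Root (?C (chain_index u) \<union> ?C (chain_index v)))"
    by (intro card_mono) auto
  also have "\<dots> \<le> Suc (card (?C (chain_index u) \<union> ?C (chain_index v)))"
    by (simp add: card_insert_if)
  also have "\<dots> \<le> Suc (card (?C (chain_index u)) + card (?C (chain_index v)))"
    by (simp add: card_Un_le)
  also have "\<dots> \<le> Suc (m + m)"
    using card_image_le[of "{1..m}" "Chain (chain_index u)"]
      card_image_le[of "{1..m}" "Chain (chain_index v)"] by simp
  \<comment> \<open>A path has one vertex more than arcs, which cancels the
    \<open>Suc\<close>.\<close>
  finally show ?thesis using distinct_card[OF p(2)] by (simp add: length_awalk_verts)
qed

text \<open>The extreme case is a path between the leaves of two chains, which exist as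
  \<open>\<Delta>\<close> is at least 2; the distance bound makes it long enough.\<close>

lemma longest_path_length_chain_tree:
  assumes "1 \<le> m" "2 \<le> \<Delta>"
  shows "longest_path_length (chain_tree m \<Delta>) = 2 * m"
proof -
  interpret graph "chain_tree m \<Delta>" by (rule graph_chain_tree)
  let ?L = "{length p | u p v. apath u p v}"
  have uv: "Chain 0 m \<in> verts (chain_tree m \<Delta>)" "Chain 1 m \<in> verts (chain_tree m \<Delta>)"
    using assms by (auto simp: verts_chain_tree)
  obtain p where p: "apath (Chain 0 m) p (Chain 1 m)"
    using chain_tree_reachable[OF uv] reachable_apath by blast
  have "real (m + m) \<le> real (length p)"
    using chain_tree_dist_ge[OF uv] graph_dist_le_length[OF wf_digraph_axioms, of "Chain 0 m" p "Chain 1 m"] p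
    by (simp add: apath_def)
  with chain_tree_apath_length[OF p] have "length p = 2 * m" by linarith
  hence "2 * m \<in> ?L" using p by (intro CollectI exI[of _ p] exI conjI) auto
  moreover have "?L \<subseteq> {..2 * m}" using chain_tree_apath_length by auto
  ultimately show ?thesis
    unfolding longest_path_length_def by (intro Max_eqI) (auto intro: finite_subset)
qed

lemma max_degree_chain_tree:
  assumes "1 \<le> m" "2 \<le> \<Delta>"
  shows "max_degree (chain_tree m \<Delta>) = \<Delta>"
proof -
  interpret graph "chain_tree m \<Delta>" by (rule graph_chain_tree)
  let ?G = "chain_tree m \<Delta>"
  have "out_arcs ?G Root = (\<lambda>i. (Root, Chain i 1)) ` {..<\<Delta>}"
    using assms(1)
    by (auto simp: out_arcs_def tail_chain_tree arcs_chain_tree chain_tree_edges_def)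
  hence root: "out_degree ?G Root = \<Delta>"
    by (simp add: out_degree_def card_image inj_on_def)
  have "out_degree ?G (Chain i j) \<le> \<Delta>" for i j
  proof -
    have "out_arcs ?G (Chain i j) \<subseteq>
        {(Chain i j, chain_node i (j - 1)), (Chain i j, chain_node i (Suc j))}"
      by (auto simp: out_arcs_def tail_chain_tree chain_node_def elim!: arcs_chain_treeE
          split: if_splits)
    hence "out_degree ?G (Chain i j) \<le>
        card {(Chain i j, chain_node i (j - 1)), (Chain i j, chain_node i (Suc j))}"
      unfolding out_degree_def by (intro card_mono) auto
    also have "\<dots> \<le> 2" by (simp add: card_insert_if)
    finally show ?thesis using assms(2) by simp
  qed
  hence "out_degree ?G v \<le> \<Delta>" for v using root by (cases v) auto
  moreover have "\<Delta> \<in> out_degree ?G ` verts ?G"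
    using root by (intro image_eqI[of _ _ Root]) (auto simp: verts_chain_tree)
  ultimately show ?thesis
    unfolding max_degree_def by (intro Max_eqI) auto
qed

lemma card_verts_chain_tree: "card (verts (chain_tree m \<Delta>)) = 1 + m * \<Delta>"
proof -
  have "card ((\<lambda>(i, j). Chain i j) ` ({..<\<Delta>} \<times> {1..m})) = \<Delta> * m"
    by (subst card_image) (auto simp: inj_on_def)
  moreover have "Root \<notin> (\<lambda>(i, j). Chain i j) ` ({..<\<Delta>} \<times> {1..m})" by auto
  ultimately show ?thesis by (simp add: verts_chain_tree)
qed

section \<open>The lower bound\<close>

text \<open>The star around the root gives the scale \<open>s\<close>, of order
  \<open>ln \<Delta> / \<epsilon>\<close>; two leaves, \<open>2 * m\<close> apart in the tree,
  multiply it by the path length.\<close>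

lemma embedding_bits_chain_tree:
  fixes \<epsilon> :: real
  assumes m: "1 \<le> m" and \<Delta>: "3 \<le> \<Delta>" and \<epsilon>: "0 < \<epsilon>" "1 + \<epsilon> \<le> real \<Delta> powr (1 / 10000)"
    and disk: "disk_embedding (chain_tree m \<Delta>) f"
    and wc: "wc_distortion (chain_tree m \<Delta>) f \<le> 1 + \<epsilon>"
  shows "embedding_bits (chain_tree m \<Delta>) f \<ge> 1 / 2000 * (real (2 * m) / \<epsilon> * log 2 (real \<Delta>))"
proof -
  let ?G = "chain_tree m \<Delta>"
  interpret graph ?G by (rule graph_chain_tree)
  have in_disk: "f v \<in> poincare_disk" if "v \<in> verts ?G" for v
    using disk that by (auto simp: disk_embedding_def)
  have root: "Root \<in> verts ?G" and node: "\<And>i j. i < \<Delta> \<Longrightarrow> 1 \<le> j \<Longrightarrow> j \<le> m \<Longrightarrow> Chain i j \<in> verts ?G"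
    by (auto simp: verts_chain_tree)
  have "Chain 0 1 \<in> verts ?G" using m \<Delta> by (intro node) auto
  have "graph_dist ?G u v > 0" if "u \<in> verts ?G" "v \<in> verts ?G" "u \<noteq> v" for u v
    using graph_dist_ge_1[OF wf_digraph_axioms chain_tree_reachable] that by (smt (verit))
  from ratio_bounds[OF finite_verts disk this root \<open>Chain 0 1 \<in> verts ?G\<close> _ wc]
  obtain s where s: "s > 0" and
    bounds: "\<And>u v. u \<in> verts ?G \<Longrightarrow> v \<in> verts ?G \<Longrightarrow> u \<noteq> v \<Longrightarrow>
      s * graph_dist ?G u v \<le> hyp_dist (f u) (f v) \<and>
      hyp_dist (f u) (f v) \<le> (1 + \<epsilon>) * s * graph_dist ?G u v" by blast
  have far: "s * real (j + l) \<le> hyp_dist (f (Chain i j)) (f (Chain k l))"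
    if "Chain i j \<in> verts ?G" "Chain k l \<in> verts ?G" "i \<noteq> k" for i j k l
  proof -
    have "s * real (j + l) \<le> s * graph_dist ?G (Chain i j) (Chain k l)"
      using chain_tree_dist_ge[OF that] s by (intro mult_left_mono) auto
    also have "\<dots> \<le> hyp_dist (f (Chain i j)) (f (Chain k l))"
      using bounds[OF that(1,2)] that(3) by simp
    finally show ?thesis .
  qed
  have "ln (real \<Delta>) / 500 \<le> s * \<epsilon>"
  proof (rule star_scale_bound[OF \<Delta> s \<epsilon>])
    show "f Root \<in> poincare_disk" using in_disk root .
    show "f (Chain i 1) \<in> poincare_disk" if "i < \<Delta>" for i
      using m that by (intro in_disk node) auto
    show "s \<le> hyp_dist (f Root) (f (Chain i 1)) \<and>
        hyp_dist (f Root) (f (Chain i 1)) \<le> (1 + \<epsilon>) * s" if "i < \<Delta>" for i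
      using bounds[OF root node[of i 1]] chain_tree_dist_root[OF that m] that m by simp
    show "2 * s \<le> hyp_dist (f (Chain i 1)) (f (Chain j 1))"
      if "i < \<Delta>" "j < \<Delta>" "i \<noteq> j" for i j
      using far[OF node[of i 1] node[of j 1]] that m by simp
  qed
  hence s_ge: "ln (real \<Delta>) / (500 * \<epsilon>) \<le> s" using \<epsilon> by (simp add: field_simps)
  have bits: "hyp_dist 0 (f v) \<le> 2 * ln 2 * embedding_bits ?G f" if "v \<in> verts ?G" for v
  proof -
    have "hyp_dist 0 (f v) / (2 * ln 2) \<le> point_bits (f v)"
      by (rule point_bits_ge_hyp_dist[OF in_disk[OF that]])
    also have "\<dots> \<le> embedding_bits ?G f"
      unfolding embedding_bits_def using that by (intro Max_ge) auto
    finally show ?thesis by (simp add: field_simps)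
  qed
  have leaves: "Chain 0 m \<in> verts ?G" "Chain 1 m \<in> verts ?G" using m \<Delta> by (auto intro!: node)
  \<comment> \<open>The triangle goes through the origin rather than through \<open>f Root\<close>,
    since precision is measured from the origin and the root may be placed anywhere.\<close>
  have "s * real (m + m) \<le> hyp_dist 0 (f (Chain 0 m)) + hyp_dist 0 (f (Chain 1 m))"
    using far[OF leaves] hyp_dist_triangle[OF _ leaves[THEN in_disk], of 0]
    by (simp add: poincare_disk_iff)
  hence "2 * real m * s \<le> 4 * ln 2 * embedding_bits ?G f"
    using bits[OF leaves(1)] bits[OF leaves(2)] by simp
  moreover have "2 * real m * (ln (real \<Delta>) / (500 * \<epsilon>)) \<le> 2 * real m * s"
    using s_ge by (intro mult_left_mono) auto
  ultimately have "2 * real m * (ln (real \<Delta>) / (500 * \<epsilon>)) \<le> 4 * ln 2 * embedding_bits ?G f"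
    by linarith
  \<comment> \<open>The constant is 1/(4 * 500); the factor \<open>ln 2\<close> turns
    \<open>ln\<close> into \<open>log 2\<close>.\<close>
  thus ?thesis using \<epsilon> by (simp add: log_def field_simps)
qed

theorem lemmaD1:
  shows "(\<forall>m \<Delta>. 1 \<le> m \<and> 3 \<le> \<Delta> \<longrightarrow>
            graph (chain_tree m \<Delta>) \<and>
            card (verts (chain_tree m \<Delta>)) = 1 + m * \<Delta> \<and>
            longest_path_length (chain_tree m \<Delta>) = 2 * m \<and>
            max_degree (chain_tree m \<Delta>) = \<Delta>) \<and>
         (\<exists>c :: real. c > 0 \<and> (\<exists>\<kappa> :: real. \<kappa> > 0 \<and>
            (\<forall>m \<Delta> (\<epsilon> :: real) f.
               1 \<le> m \<and> 3 \<le> \<Delta> \<and> 0 < \<epsilon> \<and> 1 + \<epsilon> \<le> real \<Delta> powr \<kappa> \<and>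
               disk_embedding (chain_tree m \<Delta>) f \<and>
               wc_distortion (chain_tree m \<Delta>) f \<le> 1 + \<epsilon> \<longrightarrow>
               embedding_bits (chain_tree m \<Delta>) f \<ge>
                 c * (real (longest_path_length (chain_tree m \<Delta>)) / \<epsilon>
                      * log 2 (real (max_degree (chain_tree m \<Delta>)))))))"
proof (intro conjI allI impI; (elim conjE)?)
  fix m \<Delta> :: nat
  assume "1 \<le> m" "3 \<le> \<Delta>"
  thus "longest_path_length (chain_tree m \<Delta>) = 2 * m" "max_degree (chain_tree m \<Delta>) = \<Delta>"
    by (simp_all add: longest_path_length_chain_tree max_degree_chain_tree)
next
  show "\<exists>c :: real. c > 0 \<and> (\<exists>\<kappa> :: real. \<kappa> > 0 \<and>
            (\<forall>m \<Delta> (\<epsilon> :: real) f.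
               1 \<le> m \<and> 3 \<le> \<Delta> \<and> 0 < \<epsilon> \<and> 1 + \<epsilon> \<le> real \<Delta> powr \<kappa> \<and>
               disk_embedding (chain_tree m \<Delta>) f \<and>
               wc_distortion (chain_tree m \<Delta>) f \<le> 1 + \<epsilon> \<longrightarrow>
               embedding_bits (chain_tree m \<Delta>) f \<ge>
                 c * (real (longest_path_length (chain_tree m \<Delta>)) / \<epsilon>
                      * log 2 (real (max_degree (chain_tree m \<Delta>))))))"
  \<comment> \<open>The witnesses are the constant of \<open>embedding_bits_chain_tree\<close> and
    the exponent of \<open>star_scale_bound\<close>.\<close>
  proof (rule exI[of _ "1 / 2000"], rule conjI, simp, rule exI[of _ "1 / 10000"], rule conjI, simp,
      intro allI impI, elim conjE)
    fix m \<Delta> \<epsilon> f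
    assume "1 \<le> m" "3 \<le> \<Delta>" and a: "0 < \<epsilon>" "1 + \<epsilon> \<le> real \<Delta> powr (1 / 10000)"
      "disk_embedding (chain_tree m \<Delta>) f" "wc_distortion (chain_tree m \<Delta>) f \<le> 1 + \<epsilon>"
    hence "longest_path_length (chain_tree m \<Delta>) = 2 * m" "max_degree (chain_tree m \<Delta>) = \<Delta>"
      by (simp_all add: longest_path_length_chain_tree max_degree_chain_tree)
    thus "1 / 2000 * (real (longest_path_length (chain_tree m \<Delta>)) / \<epsilon>
          * log 2 (real (max_degree (chain_tree m \<Delta>)))) \<le> embedding_bits (chain_tree m \<Delta>) f"
      using embedding_bits_chain_tree[OF \<open>1 \<le> m\<close> \<open>3 \<le> \<Delta>\<close> a] by simp
  qed
qed (auto intro: graph_chain_tree simp: card_verts_chain_tree)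

end
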